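(* Let $b$ be an odd integer with $b \equiv \pm 1 \pmod 8$, and let $q$ be a prime such that $2$ is a primitive root modulo $q$ and $q$ does not divide $b$. Suppose $(p_k)_{k=0}^{q-2}$ is a sequence of primes such that $p_k = 2p_{k-1} + b$ for all $1 \leq k \leq q-2$. Then at least one of the following holds: (a) $q$ divides $p_0 + b$; (b) $p_0 = q$; (c) $p_1 = q$; (d) $p_0 = 2$.
   Context: A sequence of primes $(p_k)_{k=0}^{\lambda-1}$ with $p_k = a p_{k-1} + b$ for all $1 \le k \le \lambda-1$ is called a prime chain of length $\lambda$ based on the pair $(a,b)$; here $a=2$ and the length is $q-1$. The paper's standing assumption is that the chains considered are strictly increasing sequences. *)

theory Defs
  imports "HOL-Number_Theory.Number_Theory"
begin

(* A chain of length l consists of the terms p 0, ..., p (l - 1); the values of p at indices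
   k \<ge> l are irrelevant.  The terms are integers because a and b may be negative, but
   prime on int only holds of positive integers. *)
definition prime_chain :: "int \<Rightarrow> int \<Rightarrow> nat \<Rightarrow> (nat \<Rightarrow> int) \<Rightarrow> bool" where
  "prime_chain a b l p \<longleftrightarrow>
     (\<forall>k<l. prime (p k)) \<and> (\<forall>k. 1 \<le> k \<and> k < l \<longrightarrow> p k = a * p (k - 1) + b)"

end

(* Since p k + b = 2^k (p 0 + b) and the powers of 2 exhaust the nonzero residues modulo q,
   if q does not divide p 0 + b then q divides, hence equals, some term p k with k < q - 1.
   If k \<ge> 2 and p 0 is odd, then q = 4 p (k - 2) + 3 b with p (k - 2) odd, so that
   q = 4 + 3 b = \<plusminus>1 modulo 8.  By Gauss's lemma 2 is then a square modulo q and
   cannot be a primitive root. *)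
theory Submission
  imports Defs
begin

text \<open>The doubles of 1, ..., (p - 1) div 2 are less than \<open>p\<close>, so reducing them
  modulo \<open>p\<close> changes nothing. The residues counted in Gauss's lemma are then simply the
  doubles exceeding (p - 1) div 2.\<close>

lemma GAUSS_two_E:
  assumes "GAUSS p 2"
  shows "GAUSS.E p 2 = (\<lambda>x. x * 2) ` {(int p - 1) div 4 <.. (int p - 1) div 2}"
proof -
  interpret GAUSS p 2 by (fact assms)
  have C: "C = B"
  proof -
    have "x mod int p = x" if "x \<in> B" for x
      using that p_eq2 by (auto simp: B_def A_def)
    then show ?thesis by (auto simp: C_def)
  qed
  show ?thesis
  proof (intro equalityI subsetI)
    fix y assume "y \<in> E"
    then obtain x where x: "y = x * 2" "x \<le> (int p - 1) div 2" "(int p - 1) div 2 < x * 2"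
      by (auto simp: E_def C B_def A_def)
    then have "(int p - 1) div 4 < x" by linarith
    with x show "y \<in> (\<lambda>x. x * 2) ` {(int p - 1) div 4 <.. (int p - 1) div 2}" by simp
  next
    fix y assume "y \<in> (\<lambda>x. x * 2) ` {(int p - 1) div 4 <.. (int p - 1) div 2}"
    then obtain x where x: "y = x * 2" "(int p - 1) div 4 < x" "x \<le> (int p - 1) div 2"
      by auto
    moreover have "0 < x" "(int p - 1) div 2 < x * 2" using x p_ge_2 by linarith+
    ultimately show "y \<in> E" by (auto simp: E_def C B_def A_def)
  qed
qed

text \<open>Gauss's lemma evaluates the power as (-1) to the number of elements of \<open>E\<close>,
  which is even in both residue classes.\<close>

lemma two_power_half_cong_1:
  fixes p :: nat
  assumes "prime p" "2 < p" and p8: "[int p = 1] (mod 8) \<or> [int p = -1] (mod 8)"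
  shows "[2 ^ ((p - 1) div 2) = 1] (mod p)"
proof -
  have "\<not> int p dvd 2" using assms(2) by (auto dest: zdvd_imp_le)
  then interpret GAUSS p 2
    using assms by unfold_locales (auto simp: cong_0_iff)
  have "card E = nat ((int p - 1) div 2 - (int p - 1) div 4)"
    by (simp add: GAUSS_two_E[OF GAUSS_axioms] card_image inj_on_def)
  moreover have "even (nat ((int p - 1) div 2 - (int p - 1) div 4))"
  proof -
    consider "int p mod 8 = 1" | "int p mod 8 = 7"
      using p8 by (auto simp: cong_def)
    \<comment> \<open>For p = 8 m + 1 the difference is 4 m - 2 m = 2 m; for p = 8 m + 7 it is (4 m
      + 3) - (2 m + 1) = 2 m + 2.\<close>
    then have "even ((int p - 1) div 2 - (int p - 1) div 4)"
      by cases presburger+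
    then show ?thesis using assms(2) by (simp add: even_nat_iff)
  qed
  ultimately have "[2 ^ nat ((int p - 1) div 2) = (1::int)] (mod int p)"
    using pre_gauss_lemma by simp
  moreover have "nat ((int p - 1) div 2) = (p - 1) div 2" using assms(2) by linarith
  ultimately have "[int (2 ^ ((p - 1) div 2)) = int 1] (mod int p)" by simp
  then show ?thesis unfolding cong_int_iff .
qed

text \<open>The order of 2 divides (p - 1) div 2, whereas a primitive root has order p - 1.\<close>

lemma not_residue_primroot_two:
  fixes p :: nat
  assumes "prime p" "2 < p" "[int p = 1] (mod 8) \<or> [int p = -1] (mod 8)"
  shows "\<not> residue_primroot p 2"
proof
  assume "residue_primroot p 2"
  then have "ord p 2 = p - 1"
    using assms(1) by (simp add: residue_primroot_def totient_prime)
  with two_power_half_cong_1[OF assms] have "p - 1 dvd (p - 1) div 2"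
    by (metis ord_divides)
  then have "p - 1 \<le> (p - 1) div 2" using assms(2) by (intro dvd_imp_le) auto
  then show False using assms(2) by linarith
qed

text \<open>The exponent is the discrete logarithm of d / c to base \<open>g\<close>. The bound q -
  1, one full period of the powers, is the length of the chain in the theorem.\<close>

lemma residue_primroot_solve_linear:
  fixes q :: nat and c d :: int
  assumes q: "prime q" and g: "residue_primroot q g"
    and c: "\<not> int q dvd c" and d: "\<not> int q dvd d"
  obtains k where "k < q - 1" "[int g ^ k * c = d] (mod int q)"
proof -
  have "coprime c (int q)"
    using q c by (metis coprime_commute prime_imp_coprime prime_nat_int_transfer)
  then obtain u where u: "[c * u = 1] (mod int q)"
    using cong_solve_coprime_int by blast
  \<comment> \<open>The least nonnegative representative of d / c, since \<open>u\<close> inverts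
    \<open>c\<close> modulo \<open>q\<close>.\<close>
  define x where "x = nat (u * d mod int q)"
  have q0: "int q > 0" using q by (simp add: prime_gt_0_nat)
  have x: "int x = u * d mod int q" using q0 by (simp add: x_def)
  have cx: "[int x * c = d] (mod int q)"
  proof -
    have "[int x * c = u * d * c] (mod int q)" by (intro cong_mult) (auto simp: x)
    also have "u * d * c = (c * u) * d" by simp
    also have "[\<dots> = 1 * d] (mod int q)" by (intro cong_mult u) auto
    finally show ?thesis by simp
  qed
  have "x \<noteq> 0"
    using cx d cong_dvd_iff by fastforce
  moreover have "x < q" using x q0 by (metis of_nat_less_iff pos_mod_bound)
  ultimately have "x \<in> totatives q"
    using q by (auto simp: totatives_prime)
  also have "totatives q = (\<lambda>i. g ^ i mod q) ` {..<q - 1}"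
    using residue_primroot_is_generator[OF prime_gt_1_nat[OF q] g] q
    by (simp add: bij_betw_def totient_prime)
  finally obtain k where k: "k < q - 1" "g ^ k mod q = x"
    by auto
  have "[int g ^ k = int x] (mod int q)"
    using k(2) by (metis cong_mod_left cong_refl of_nat_mod of_nat_power)
  then have "[int g ^ k * c = int x * c] (mod int q)" by (rule cong_scalar_right)
  with cx k(1) show thesis using that cong_trans by blast
qed

text \<open>The map sending x to 2 x + b fixes -b, so the offset from -b doubles at each
  step.\<close>

lemma two_chain_closed_form:
  assumes "prime_chain 2 b l p" "k < l"
  shows "p k + b = 2 ^ k * (p 0 + b)"
  using assms(2)
proof (induction k)
  case (Suc k)
  have "p (Suc k) = 2 * p k + b"
    using assms(1) Suc.prems unfolding prime_chain_def by force
  with Suc show ?case by simp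
qed simp

theorem theorem3:
  fixes b :: int and q :: nat and p :: "nat \<Rightarrow> int"
  assumes "odd b"
    and "[b = 1] (mod 8) \<or> [b = -1] (mod 8)"
    and "prime q"
    and "residue_primroot q 2"
    and "\<not> int q dvd b"
    and "prime_chain 2 b (q - 1) p"
    and "strict_mono_on {..<q - 1} p"
  shows "int q dvd p 0 + b \<or> p 0 = int q \<or> p 1 = int q \<or> p 0 = 2"
proof (rule ccontr)
  assume "\<not> ?thesis"
  then have neg: "\<not> int q dvd p 0 + b" "p 0 \<noteq> int q" "p 1 \<noteq> int q" "p 0 \<noteq> 2"
    by auto
  have prime: "prime (p k)" if "k < q - 1" for k
    using assms(6) that by (simp add: prime_chain_def)
  have step: "p (Suc k) = 2 * p k + b" if "Suc k < q - 1" for k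
    using assms(6) that unfolding prime_chain_def by force
  \<comment> \<open>The target is \<open>b\<close> because p k + b = b modulo \<open>q\<close> says
    exactly that \<open>q\<close> divides \<open>p k\<close>.\<close>
  obtain k where k: "k < q - 1" "[2 ^ k * (p 0 + b) = b] (mod int q)"
    using residue_primroot_solve_linear[OF assms(3,4) neg(1) assms(5)] by auto
  then have "int q dvd p k"
    using two_chain_closed_form[OF assms(6) k(1)]
    by (metis add_diff_cancel_right' cong_iff_dvd_diff)
  then have pk: "p k = int q"
    using prime[OF k(1)] assms(3) by (metis primes_dvd_imp_eq prime_nat_int_transfer)
  with neg obtain j where j: "k = Suc (Suc j)"
    by (metis One_nat_def not0_implies_Suc)
  \<comment> \<open>For j = 0 this is where p 0 \<noteq> 2 enters; every later term is odd because
    \<open>b\<close> is.\<close>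
  have "odd (p j)"
  proof (cases j)
    case 0
    have "prime (p 0)" using k(1) by (intro prime) simp
    moreover have "p 0 > 2" using prime_ge_2_int[OF \<open>prime (p 0)\<close>] neg(4) by simp
    ultimately show ?thesis using 0 prime_odd_int by simp
  next
    case (Suc i)
    then show ?thesis using step[of i] k(1) j assms(1) by simp
  qed
  moreover have "int q = 4 * p j + 3 * b"
    using step[of j] step[of "Suc j"] j k(1) pk by simp
  moreover have "b mod 8 = 1 \<or> b mod 8 = 7" using assms(2) by (auto simp: cong_def)
  \<comment> \<open>As \<open>p j\<close> is odd, 4 * p j = 4 modulo 8, and 4 + 3 b swaps the
    classes 1 and 7.\<close>
  ultimately have "int q mod 8 = 1 \<or> int q mod 8 = 7" by presburger
  then have "[int q = 1] (mod 8) \<or> [int q = -1] (mod 8)" by (auto simp: cong_def)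
  moreover have "2 < q" using j k(1) by simp
  ultimately show False
    using not_residue_primroot_two assms(3,4) by blast
qed

end
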